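(* Let $k\in\mathbb{N}$. For $x>0$, the improper integral $H_z^{(k)}(x)=\int_0^\infty t^{z-k}\cos(xt)\cos(t^{-k})\,dt$ converges for all $z\in\mathbb{C}$ with $-1<\operatorname{Re}(z)<k$. For $x=0$, it converges for $-1<\operatorname{Re}(z)<k-1$. *)

theory Defs
  imports "HOL-Analysis.Analysis"
begin

text \<open>
  Improper integrals over \<open>(0, \<infinity>)\<close>, both endpoints being approached independently of each
  other. Absolute convergence is not required, so Lebesgue integrability on \<open>(0, \<infinity>)\<close> would
  be too strong.
\<close>

definition has_improper_integral :: "(real \<Rightarrow> 'a::banach) \<Rightarrow> 'a \<Rightarrow> bool" where
  "has_improper_integral f L \<longleftrightarrow>
     (\<forall>a b. 0 < a \<and> a \<le> b \<longrightarrow> f integrable_on {a..b}) \<and>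
     ((\<lambda>(a, b). integral {a..b} f) \<longlongrightarrow> L) (at_right 0 \<times>\<^sub>F at_top)"

definition improper_integral_converges :: "(real \<Rightarrow> 'a::banach) \<Rightarrow> bool" where
  "improper_integral_converges f \<longleftrightarrow> (\<exists>L. has_improper_integral f L)"

text \<open>For \<open>t > 0\<close> the principal complex power below is \<open>exp ((z - k) * ln t)\<close>.\<close>

definition H_integrand :: "nat \<Rightarrow> complex \<Rightarrow> real \<Rightarrow> real \<Rightarrow> complex" where
  "H_integrand k z x t =
     complex_of_real t powr (z - of_nat k) *
     complex_of_real (cos (x * t)) * complex_of_real (cos (t powi (- int k)))"

end

theory Submission
  imports Defs
begin

text \<open>
  At a critical endpoint the integrand \<open>f\<close> is written as \<open>F' - g\<close> by one integration by parts,
  where \<open>F\<close> has a limit and \<open>g\<close> is dominated by an integrable power of \<open>t\<close>. Near \<open>0\<close> one integrates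
  the factor \<open>t\<^bsup>-k-1\<^esup> cos (t\<^bsup>-k\<^esup>)\<close>, and near infinity, for \<open>x > 0\<close>, the factor \<open>cos (x t)\<close>.
  For \<open>k = 0\<close> near \<open>0\<close> and for \<open>x = 0\<close> near infinity, \<open>f\<close> itself is dominated.
\<close>

section \<open>Cauchy criterion and reduction to separate limits at 0 and at infinity\<close>

text \<open>The convergent \<open>G\<close> controls the oscillation of \<open>\<Phi>\<close>, so
  the image filter is Cauchy and completeness supplies a limit without a candidate for it.\<close>

lemma convergent_of_dist_le:
  fixes \<Phi> :: "'a \<Rightarrow> 'b::complete_space" and G :: "'a \<Rightarrow> 'c::metric_space"
  assumes G: "(G \<longlongrightarrow> l) \<F>" and S: "eventually (\<lambda>s. s \<in> S) \<F>" and nb: "\<F> \<noteq> bot"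
    and le: "\<And>s t. s \<in> S \<Longrightarrow> t \<in> S \<Longrightarrow> dist (\<Phi> s) (\<Phi> t) \<le> dist (G s) (G t)"
  shows "\<exists>L. (\<Phi> \<longlongrightarrow> L) \<F>"
proof -
  have "cauchy_filter (filtermap \<Phi> \<F>)"
    unfolding cauchy_filter_metric_filtermap
  proof (intro allI impI)
    fix e :: real assume "e > 0"
    then have "eventually (\<lambda>s. s \<in> S \<and> dist (G s) l < e / 2) \<F>"
      using tendstoD[OF G, of "e / 2"] S by (auto intro: eventually_conj)
    moreover have "dist (\<Phi> s) (\<Phi> t) < e"
      if "s \<in> S \<and> dist (G s) l < e / 2" "t \<in> S \<and> dist (G t) l < e / 2" for s t
      using le[of s t] that dist_triangle_half_l[of "G s" l e "G t"] by linarith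
    ultimately show "\<exists>P. eventually P \<F> \<and> (\<forall>s t. P s \<and> P t \<longrightarrow> dist (\<Phi> s) (\<Phi> t) < e)"
      by blast
  qed
  then obtain L where "filtermap \<Phi> \<F> \<le> nhds L"
    using cauchy_filter_complete_converges[of "filtermap \<Phi> \<F>" UNIV] nb complete_UNIV
    by (auto simp: filtermap_bot_iff)
  then show ?thesis
    by (auto simp: filterlim_def)
qed

definition primitive_from_1 :: "(real \<Rightarrow> 'a::banach) \<Rightarrow> real \<Rightarrow> 'a" where
  "primitive_from_1 f t = integral {1..t} f - integral {t..1} f"

lemma primitive_from_1_diff:
  fixes f :: "real \<Rightarrow> 'a::banach"
  assumes f: "continuous_on {0<..} f" and st: "0 < s" "s \<le> t"
  shows "integral {s..t} f = primitive_from_1 f t - primitive_from_1 f s"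
proof -
  have int: "f integrable_on {a..b}" if "0 < a" for a b
    using that by (intro integrable_continuous_real continuous_on_subset[OF f]) auto
  have comb: "integral {a..c} f + integral {c..b} f = integral {a..b} f"
    if "0 < a" "a \<le> c" "c \<le> b" for a b c
    using that int by (intro Henstock_Kurzweil_Integration.integral_combine) auto
  have nil: "integral {a..b} f = 0" if "b \<le> a" for a b
    using that by (cases "a = b") auto
  consider "t \<le> 1" | "1 \<le> s" | "s \<le> 1" "1 \<le> t" by linarith
  then show ?thesis
    unfolding primitive_from_1_def
  proof cases
    case 1
    then show "integral {s..t} f = integral {1..t} f - integral {t..1} f - (integral {1..s} f - integral {s..1} f)"
      using comb[of s t 1] nil[of t 1] nil[of s 1] st by (simp add: algebra_simps)
  next
    case 2
    then show "integral {s..t} f = integral {1..t} f - integral {t..1} f - (integral {1..s} f - integral {s..1} f)"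
      using comb[of 1 s t] nil[of 1 s] nil[of 1 t] st by (simp add: algebra_simps)
  next
    case 3
    then show "integral {s..t} f = integral {1..t} f - integral {t..1} f - (integral {1..s} f - integral {s..1} f)"
      using comb[of s 1 t] nil[of s 1] nil[of 1 t] st by (simp add: algebra_simps)
  qed
qed

text \<open>The integral over \<open>{a..b}\<close> is a difference of a function of
  \<open>b\<close> and a function of \<open>a\<close>, so the limit along the product filter follows
  from two one-variable limits.\<close>

lemma improper_integral_convergesI:
  fixes f :: "real \<Rightarrow> 'a::banach"
  assumes f: "continuous_on {0<..} f"
    and A: "\<exists>A. (primitive_from_1 f \<longlongrightarrow> A) (at_right 0)"
    and B: "\<exists>B. (primitive_from_1 f \<longlongrightarrow> B) at_top"
  shows "improper_integral_converges f"
proof -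
  let ?\<Phi> = "primitive_from_1 f"
  from A B obtain A B where AB: "(?\<Phi> \<longlongrightarrow> A) (at_right 0)" "(?\<Phi> \<longlongrightarrow> B) at_top" by blast
  have "((\<lambda>p. ?\<Phi> (snd p) - ?\<Phi> (fst p)) \<longlongrightarrow> B - A) (at_right 0 \<times>\<^sub>F at_top)"
    by (intro tendsto_diff filterlim_compose[OF AB(1)] filterlim_compose[OF AB(2)]
        filterlim_fst filterlim_snd)
  moreover have "\<forall>\<^sub>F p in at_right 0 \<times>\<^sub>F at_top.
      ?\<Phi> (snd p) - ?\<Phi> (fst p) = (case p of (a, b) \<Rightarrow> integral {a..b} f)"
  proof -
    \<comment> \<open>Together with \<open>b \<ge> 1\<close> this forces \<open>a \<le> b\<close>,
      as the difference formula requires.\<close>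
    have "\<forall>\<^sub>F a in at_right (0::real). 0 < a \<and> a < 1"
      by (simp add: eventually_at_right_field) (metis zero_less_one)
    from eventually_prodI[OF this eventually_ge_at_top[of "1::real"]] show ?thesis
      by (rule eventually_mono) (auto simp: primitive_from_1_diff[OF f])
  qed
  ultimately have "((\<lambda>(a, b). integral {a..b} f) \<longlongrightarrow> B - A) (at_right 0 \<times>\<^sub>F at_top)"
    by (rule Lim_transform_eventually)
  moreover have "f integrable_on {a..b}" if "0 < a" for a b
    using that by (intro integrable_continuous_real continuous_on_subset[OF f]) auto
  ultimately show ?thesis
    unfolding improper_integral_converges_def has_improper_integral_def by blast
qed

section \<open>Convergence by partial integration with a power-dominated remainder\<close>

text \<open>The primitive of \<open>f\<close> minus \<open>F\<close> has derivative
  \<open>-g\<close>, so its increments are bounded by those of a primitive of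
  \<open>C * t powr p\<close>, which converges along the filter. Adding the convergent
  \<open>F\<close> back gives the claim.\<close>

lemma primitive_convergent:
  fixes f g F :: "real \<Rightarrow> 'a::banach"
  assumes f: "continuous_on {0<..} f"
    and S: "S \<subseteq> {0<..}" "is_interval S" "eventually (\<lambda>t. t \<in> S) \<F>" "\<F> \<noteq> bot"
    and deriv: "\<And>t. t \<in> S \<Longrightarrow> (F has_vector_derivative f t + g t) (at t)"
    and bound: "\<And>t. t \<in> S \<Longrightarrow> norm (g t) \<le> C * t powr p"
    and F: "(F \<longlongrightarrow> A) \<F>"
    and p: "p \<noteq> -1" "((\<lambda>t. t powr (p + 1)) \<longlongrightarrow> l) \<F>"
  shows "\<exists>L. (primitive_from_1 f \<longlongrightarrow> L) \<F>"
proof -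
  let ?\<Phi> = "primitive_from_1 f"
  \<comment> \<open>The power primitive of the bound; \<open>p \<noteq> -1\<close> excludes the
    logarithm. Only increments of \<open>G\<close> enter, so the sign of \<open>p + 1\<close> does
    not matter.\<close>
  define G where "G t = C * t powr (p + 1) / (p + 1)" for t
  have main: "norm ((?\<Phi> t - F t) - (?\<Phi> s - F s)) \<le> G t - G s"
    if st: "s \<in> S" "t \<in> S" "s \<le> t" for s t
  proof -
    have sub: "{s..t} \<subseteq> S"
      using mem_is_interval_1_I[OF S(2) st(1,2)] by auto
    have pos: "0 < u" if "u \<in> {s..t}" for u
      using that sub S(1) by blast
    have s0: "0 < s" using st(1) S(1) by auto
    have "f integrable_on {s..t}"
      using s0 by (intro integrable_continuous_real continuous_on_subset[OF f]) auto
    then have f_int: "(f has_integral (?\<Phi> t - ?\<Phi> s)) {s..t}"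
      using primitive_from_1_diff[OF f s0 st(3)] by (simp add: has_integral_iff)
    have "((\<lambda>u. f u + g u) has_integral (F t - F s)) {s..t}"
      using has_vector_derivative_at_within[OF deriv] sub
      by (intro fundamental_theorem_of_calculus[OF st(3)]) blast
    from has_integral_diff[OF this f_int]
    have g: "(g has_integral ((F t - F s) - (?\<Phi> t - ?\<Phi> s))) {s..t}"
      by simp
    have G: "((\<lambda>u. C * u powr p) has_integral (G t - G s)) {s..t}"
    proof (intro fundamental_theorem_of_calculus)
      fix u assume "u \<in> {s..t}"
      then have "(G has_real_derivative C * u powr p) (at u)"
        unfolding G_def using pos p(1)
        by (auto intro!: derivative_eq_intros simp: add_eq_0_iff2)
      then show "(G has_vector_derivative C * u powr p) (at u within {s..t})"
        by (simp add: has_real_derivative_iff_has_vector_derivative has_vector_derivative_at_within)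
    qed (use st in auto)
    have "norm ((F t - F s) - (?\<Phi> t - ?\<Phi> s)) \<le> G t - G s"
      using integral_norm_bound_integral[OF has_integral_integrable[OF g] has_integral_integrable[OF G]]
        bound sub unfolding integral_unique[OF g] integral_unique[OF G] by blast
    then show ?thesis
      by (simp add: norm_minus_commute algebra_simps)
  qed
  \<comment> \<open>The boundary term \<open>F\<close> is subtracted first: it converges, but
    \<open>G\<close> need not control its increments.\<close>
  have "\<exists>L. ((\<lambda>t. ?\<Phi> t - F t) \<longlongrightarrow> L) \<F>"
  proof (rule convergent_of_dist_le)
    show "(G \<longlongrightarrow> C * l / (p + 1)) \<F>"
      unfolding G_def using p by (intro tendsto_intros) (auto simp: add_eq_0_iff2)
    fix s t assume "s \<in> S" "t \<in> S"
    then show "dist (?\<Phi> s - F s) (?\<Phi> t - F t) \<le> dist (G s) (G t)"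
      using main[of s t] main[of t s]
      by (cases "s \<le> t") (auto simp: dist_norm norm_minus_commute)
  qed (use S in auto)
  then obtain L where "((\<lambda>t. ?\<Phi> t - F t) \<longlongrightarrow> L) \<F>" by blast
  from tendsto_add[OF this F] show ?thesis by auto
qed

lemma primitive_convergent_at_right_0:
  fixes f g F :: "real \<Rightarrow> 'a::banach"
  assumes "continuous_on {0<..} f"
    and "\<And>t. 0 < t \<Longrightarrow> t \<le> 1 \<Longrightarrow> (F has_vector_derivative f t + g t) (at t)"
    and "\<And>t. 0 < t \<Longrightarrow> t \<le> 1 \<Longrightarrow> norm (g t) \<le> C * t powr p"
    and "(F \<longlongrightarrow> A) (at_right 0)" and p: "p > -1"
  shows "\<exists>L. (primitive_from_1 f \<longlongrightarrow> L) (at_right 0)"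
proof (rule primitive_convergent[where S = "{0<..1}"])
  show "((\<lambda>t. t powr (p + 1)) \<longlongrightarrow> 0) (at_right (0::real))"
    using p by (intro tendsto_zero_powrI[of _ _ _ "p + 1"] tendsto_intros) (auto simp: eventually_at_filter)
  show "\<forall>\<^sub>F t in at_right 0. t \<in> {0<..1::real}"
    by (simp add: eventually_at_right_field) (metis less_imp_le zero_less_one)
qed (use assms in auto)

lemma primitive_convergent_at_top:
  fixes f g F :: "real \<Rightarrow> 'a::banach"
  assumes "continuous_on {0<..} f"
    and "\<And>t. 1 \<le> t \<Longrightarrow> (F has_vector_derivative f t + g t) (at t)"
    and "\<And>t. 1 \<le> t \<Longrightarrow> norm (g t) \<le> C * t powr p"
    and "(F \<longlongrightarrow> A) at_top" and p: "p < -1"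
  shows "\<exists>L. (primitive_from_1 f \<longlongrightarrow> L) at_top"
proof (rule primitive_convergent[where S = "{1..}"])
  show "((\<lambda>t. t powr (p + 1)) \<longlongrightarrow> 0) (at_top :: real filter)"
    using p by (intro tendsto_neg_powr filterlim_ident) auto
qed (use assms eventually_ge_at_top[of "1::real"] in auto)

section \<open>Derivatives and norms of complex powers times real factors\<close>

text \<open>Both boundary terms below have this shape. The condition \<open>t > 0\<close> keeps the
  base off the branch cut of the complex power.\<close>

lemma has_vector_derivative_powr_times_real:
  fixes w :: complex
  assumes "t > 0" and u: "(u has_real_derivative u') (at t)"
  shows "((\<lambda>t. of_real t powr w * of_real (u t)) has_vector_derivative
           of_real t powr w * of_real u' + w * of_real t powr (w - 1) * of_real (u t)) (at t)"
proof -
  have "((\<lambda>y. y powr w) has_field_derivative w * of_real t powr (w - 1)) (at (of_real t))"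
    using assms(1) by (intro has_field_derivative_powr) (auto simp: complex_nonpos_Reals_iff)
  from has_vector_derivative_mult[OF has_vector_derivative_real_field[OF this]
      has_vector_derivative_of_real[OF u]]
  show ?thesis by simp
qed

lemma has_real_derivative_inverse_power:
  assumes "t > (0::real)"
  shows "((\<lambda>t. inverse (t ^ k)) has_real_derivative - real k * inverse (t ^ Suc k)) (at t)"
proof -
  have "((\<lambda>t. inverse (t ^ k)) has_real_derivative
      - (inverse (t ^ k) * (real k * t ^ (k - Suc 0)) * inverse (t ^ k))) (at t)"
    using assms by (auto intro!: derivative_eq_intros)
  also have "- (inverse (t ^ k) * (real k * t ^ (k - Suc 0)) * inverse (t ^ k))
      = - real k * inverse (t ^ Suc k)"
    \<comment> \<open>At \<open>k = 0\<close> the truncated exponent \<open>k - Suc 0\<close> is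
      harmless, because the factor \<open>real k\<close> makes both sides vanish.\<close>
    using assms by (cases k) (simp_all add: field_simps del: of_nat_Suc)
  finally show ?thesis .
qed

lemma norm_powr_times_real_le:
  assumes "t > 0" and "\<bar>u\<bar> \<le> c"
  shows "norm (of_real t powr w * of_real u :: complex) \<le> c * t powr Re w"
  using assms by (simp add: norm_mult norm_powr_real_powr mult.commute mult_right_mono)

text \<open>Gathers the cosines into one real factor, the form to which the derivative and norm
  lemmas for complex powers apply.\<close>

lemma H_integrand_eq:
  "H_integrand k z x t = of_real t powr (z - of_nat k) * of_real (cos (x * t) * cos (inverse (t ^ k)))"
  by (simp add: H_integrand_def power_int_minus mult.assoc)

lemma continuous_on_H_integrand: "continuous_on {0<..} (H_integrand k z x)"
  unfolding H_integrand_eq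
  by (intro continuous_intros) (auto simp: complex_nonpos_Reals_iff)

lemma abs_mult_le_1: "\<bar>a\<bar> \<le> 1 \<Longrightarrow> \<bar>b\<bar> \<le> 1 \<Longrightarrow> \<bar>a * b\<bar> \<le> (1::real)"
  by (simp add: abs_mult mult_le_one)

lemma norm_H_integrand_le:
  assumes "t > 0"
  shows "norm (H_integrand k z x t) \<le> t powr (Re z - real k)"
  using norm_powr_times_real_le[OF assms, of "cos (x * t) * cos (inverse (t ^ k))" 1 "z - of_nat k"]
  by (simp add: H_integrand_eq abs_mult_le_1)

lemma of_real_powr_divide_power:
  assumes "t > 0"
  shows "of_real t powr w * of_real (inverse (t ^ n)) = (of_real t powr (w - of_nat n) :: complex)"
  using assms by (simp add: powr_diff powr_nat' field_simps)

section \<open>The integrand at each endpoint\<close>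

text \<open>For \<open>k > 0\<close>, integrating \<open>t^(-k-1) cos (t^(-k))\<close> leaves the
  power \<open>t^(z+1)\<close>. The boundary term then tends to 0 and the remainder is of order
  \<open>t^(Re z)\<close>, integrable at 0, both because \<open>Re z > -1\<close>.\<close>

lemma H_convergent_at_right_0:
  assumes z: "- 1 < Re z"
  shows "\<exists>L. (primitive_from_1 (H_integrand k z x) \<longlongrightarrow> L) (at_right 0)"
proof (cases "k = 0")
  case True
  show ?thesis
  \<comment> \<open>With \<open>F = 0\<close> and \<open>g = -f\<close> the derivative condition is
    trivial and the criterion becomes plain comparison with a power.\<close>
  proof (rule primitive_convergent_at_right_0[OF continuous_on_H_integrand,
        where F = "\<lambda>_. 0" and g = "\<lambda>t. - H_integrand k z x t" and C = 1 and p = "Re z"])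
    fix t :: real assume "0 < t"
    then show "norm (- H_integrand k z x t) \<le> 1 * t powr Re z"
      using norm_H_integrand_le[of t k z x] True by simp
  qed (use z in auto)
next
  case False
  define q where "q t = inverse (t ^ k)" for t :: real
  \<comment> \<open>The factor \<open>-1/k\<close> cancels the \<open>-k\<close> from the derivative
    of \<open>t^(-k)\<close>. In \<open>u'\<close>, the term \<open>v\<close> comes from
    differentiating \<open>cos (x * t)\<close>; the other term reproduces the integrand.\<close>
  define u where "u t = - (cos (x * t) * sin (q t)) / k" for t
  define v where "v t = x * sin (x * t) * sin (q t) / k" for t
  define F where "F t = complex_of_real t powr (z + 1) * of_real (u t)" for t
  define g where "g t = of_real t powr (z + 1) * of_real (v t)
                        + (z + 1) * (of_real t powr z * of_real (u t))" for t
  have u_le: "\<bar>u t\<bar> \<le> 1" for t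
  proof -
    have "\<bar>cos (x * t) * sin (q t)\<bar> \<le> real k"
      using abs_mult_le_1[of "cos (x * t)" "sin (q t)"] False by simp
    then show ?thesis using False by (simp add: u_def)
  qed
  have v_le: "\<bar>v t\<bar> \<le> \<bar>x\<bar>" for t
  proof -
    have "\<bar>x\<bar> * \<bar>sin (x * t) * sin (q t)\<bar> \<le> \<bar>x\<bar> * real k"
      using abs_mult_le_1[of "sin (x * t)" "sin (q t)"] False
      by (intro mult_left_mono) auto
    then show ?thesis using False by (simp add: v_def abs_mult field_simps)
  qed
  show ?thesis
  proof (rule primitive_convergent_at_right_0[OF continuous_on_H_integrand,
        where F = F and g = g and C = "\<bar>x\<bar> + norm (z + 1)" and p = "Re z" and A = 0])
    fix t :: real assume t: "0 < t" "t \<le> 1"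
    have q: "(q has_real_derivative - real k * inverse (t ^ Suc k)) (at t)"
      unfolding q_def[abs_def] using t(1) by (rule has_real_derivative_inverse_power)
    have "(u has_real_derivative v t + cos (x * t) * cos (q t) * inverse (t ^ Suc k)) (at t)"
      unfolding u_def v_def using t False
      by (auto intro!: derivative_eq_intros q
          simp: field_simps simp del: power_Suc)
    from has_vector_derivative_powr_times_real[OF t(1) this, of "z + 1"]
    have "(F has_vector_derivative of_real t powr (z + 1) *
            of_real (v t + cos (x * t) * cos (q t) * inverse (t ^ Suc k))
            + (z + 1) * of_real t powr z * of_real (u t)) (at t)"
      by (simp add: F_def[abs_def])
    \<comment> \<open>The splitting \<open>t^(z-k) = t^(z+1) * t^(-k-1)\<close> provides the factor
      to be integrated.\<close>
    moreover have "H_integrand k z x t =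
        of_real t powr (z + 1) * of_real (cos (x * t) * cos (q t) * inverse (t ^ Suc k))"
      using of_real_powr_divide_power[OF t(1), of "z + 1" "Suc k"]
      by (simp add: H_integrand_eq q_def del: power_Suc)
    ultimately show "(F has_vector_derivative H_integrand k z x t + g t) (at t)"
      by (simp add: g_def algebra_simps del: power_Suc)
    have "norm (of_real t powr (z + 1) * of_real (v t) :: complex) \<le> \<bar>x\<bar> * t powr Re (z + 1)"
      by (rule norm_powr_times_real_le[OF t(1) v_le])
    \<comment> \<open>Since \<open>t \<le> 1\<close>, lowering the exponent enlarges the power, so
      both terms of \<open>g\<close> get the exponent \<open>Re z\<close>.\<close>
    also have "\<dots> \<le> \<bar>x\<bar> * t powr Re z"
      using t by (intro mult_left_mono powr_mono') auto
    finally have "norm (of_real t powr (z + 1) * of_real (v t) :: complex) \<le> \<bar>x\<bar> * t powr Re z" .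
    moreover have "norm ((z + 1) * (of_real t powr z * of_real (u t))) \<le> norm (z + 1) * (1 * t powr Re z)"
      unfolding norm_mult[of "z + 1"]
      by (intro mult_left_mono norm_powr_times_real_le t u_le) auto
    ultimately show "norm (g t) \<le> (\<bar>x\<bar> + norm (z + 1)) * t powr Re z"
      unfolding g_def distrib_right by (intro norm_triangle_mono) auto
  next
    have "((\<lambda>t. t powr Re (z + 1)) \<longlongrightarrow> 0) (at_right (0::real))"
      using z by (intro tendsto_zero_powrI[of _ _ _ "Re (z + 1)"] tendsto_intros)
        (auto simp: eventually_at_filter)
    moreover have "\<forall>\<^sub>F t in at_right 0. norm (F t) \<le> t powr Re (z + 1)"
      using eventually_at_right_less[of "0::real"]
      by eventually_elim (use norm_powr_times_real_le[OF _ u_le, where w = "z + 1"] in \<open>simp add: F_def\<close>)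
    ultimately show "(F \<longlongrightarrow> 0) (at_right 0)"
      by (rule Lim_null_comparison[rotated])
  qed (use z in auto)
qed

text \<open>Integrating \<open>cos (x * t)\<close> to \<open>sin (x * t) / x\<close> gains one power
  of \<open>t\<close>: the boundary term decays like \<open>t^(Re z - k)\<close>, and the remainder
  has an exponent below -1. At \<open>k = 0\<close> the function \<open>v\<close> is 0, so no case
  split arises.\<close>

lemma H_convergent_at_top:
  assumes x: "x > 0" and z: "Re z < real k"
  shows "\<exists>L. (primitive_from_1 (H_integrand k z x) \<longlongrightarrow> L) at_top"
proof -
  define w where "w = z - of_nat k"
  define q where "q t = inverse (t ^ k)" for t :: real
  define u where "u t = cos (q t) * sin (x * t) / x" for t
  \<comment> \<open>Differentiating \<open>cos (q t)\<close> yields \<open>t^(-k-1)\<close>. Only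
    \<open>t^(-k)\<close>, at most 1 for \<open>t \<ge> 1\<close>, is put into \<open>v\<close>; the
    remaining \<open>1/t\<close> lowers the exponent \<open>w\<close> to \<open>w - 1\<close>, as in
    the other term of \<open>g\<close>.\<close>
  define v where "v t = sin (q t) * sin (x * t) * (real k / x) * inverse (t ^ k)" for t
  define F where "F t = complex_of_real t powr w * of_real (u t)" for t
  define g where "g t = of_real t powr (w - 1) * of_real (v t)
                        + w * (of_real t powr (w - 1) * of_real (u t))" for t
  have u_le: "\<bar>u t\<bar> \<le> 1 / x" for t
    using abs_mult_le_1[of "cos (q t)" "sin (x * t)"] x
    by (simp add: u_def abs_mult divide_right_mono)
  have v_le: "\<bar>v t\<bar> \<le> real k / x" if "1 \<le> t" for t
  proof -
    have "\<bar>(sin (q t) * sin (x * t)) * inverse (t ^ k)\<bar> \<le> 1"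
      using that by (intro abs_mult_le_1) (auto simp: inverse_le_1_iff)
    then have "\<bar>(sin (q t) * sin (x * t)) * inverse (t ^ k)\<bar> * (real k / x) \<le> 1 * (real k / x)"
      using x by (intro mult_right_mono) auto
    then show ?thesis using x by (simp add: v_def abs_mult mult_ac)
  qed
  show ?thesis
  proof (rule primitive_convergent_at_top[OF continuous_on_H_integrand,
        where F = F and g = g and C = "real k / x + norm w * (1 / x)" and p = "Re (w - 1)" and A = 0])
    fix t :: real assume t: "1 \<le> t"
    then have t0: "0 < t" by simp
    have q: "(q has_real_derivative - real k * inverse (t ^ Suc k)) (at t)"
      unfolding q_def[abs_def] using t0 by (rule has_real_derivative_inverse_power)
    have "(u has_real_derivative v t * inverse t + cos (x * t) * cos (q t)) (at t)"
      unfolding u_def v_def using t0 x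
      by (auto intro!: derivative_eq_intros q simp: field_simps)
    from has_vector_derivative_powr_times_real[OF t0 this, of w]
    have "(F has_vector_derivative of_real t powr w *
            of_real (v t * inverse t + cos (x * t) * cos (q t))
            + w * of_real t powr (w - 1) * of_real (u t)) (at t)"
      by (simp add: F_def[abs_def])
    moreover have "of_real t powr w * of_real (inverse t) = (of_real t powr (w - 1) :: complex)"
      using of_real_powr_divide_power[OF t0, of w 1] by simp
    then have "of_real t powr w * of_real (v t * inverse t) = (of_real t powr (w - 1) * of_real (v t) :: complex)"
      by (metis mult.assoc mult.commute of_real_mult)
    ultimately show "(F has_vector_derivative H_integrand k z x t + g t) (at t)"
      by (simp only: g_def H_integrand_eq q_def w_def[symmetric] of_real_add distrib_left add_ac mult.assoc)
    have "norm (of_real t powr (w - 1) * of_real (v t) :: complex) \<le> real k / x * t powr Re (w - 1)"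
      by (rule norm_powr_times_real_le[OF t0 v_le[OF t]])
    moreover have "norm (w * (of_real t powr (w - 1) * of_real (u t)))
        \<le> norm w * (1 / x * t powr Re (w - 1))"
      unfolding norm_mult[of w]
      by (intro mult_left_mono norm_powr_times_real_le t0 u_le) auto
    ultimately show "norm (g t) \<le> (real k / x + norm w * (1 / x)) * t powr Re (w - 1)"
      unfolding g_def distrib_right mult.assoc by (intro norm_triangle_mono) auto
  next
    have "((\<lambda>t. 1 / x * t powr Re w) \<longlongrightarrow> 1 / x * 0) at_top"
      using z by (intro tendsto_intros tendsto_neg_powr filterlim_ident) (auto simp: w_def)
    moreover have "\<forall>\<^sub>F t in at_top. norm (F t) \<le> 1 / x * t powr Re w"
      using eventually_gt_at_top[of "0::real"]
      by eventually_elim (unfold F_def, rule norm_powr_times_real_le[OF _ u_le])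
    ultimately show "(F \<longlongrightarrow> 0) at_top"
      using Lim_null_comparison by auto
  qed (use z in \<open>auto simp: w_def\<close>)
qed

text \<open>Meant for \<open>x = 0\<close>, where \<open>cos (x * t)\<close> is constant and offers
  no oscillation to integrate. The bound on \<open>Re z\<close> puts the exponent
  \<open>Re z - k\<close> below -1.\<close>

lemma H_convergent_at_top_absolute:
  assumes z: "Re z < real k - 1"
  shows "\<exists>L. (primitive_from_1 (H_integrand k z x) \<longlongrightarrow> L) at_top"
proof (rule primitive_convergent_at_top[OF continuous_on_H_integrand,
      where F = "\<lambda>_. 0" and g = "\<lambda>t. - H_integrand k z x t" and C = 1 and p = "Re z - real k"])
  fix t :: real assume "1 \<le> t"
  then show "norm (- H_integrand k z x t) \<le> 1 * t powr (Re z - real k)"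
    using norm_H_integrand_le[of t k z x] by simp
qed (use z in auto)

theorem theorem4p1:
  fixes k :: nat
  shows "(\<forall>x>0. \<forall>z. - 1 < Re z \<and> Re z < real k \<longrightarrow>
            improper_integral_converges (H_integrand k z x)) \<and>
         (\<forall>z. - 1 < Re z \<and> Re z < real k - 1 \<longrightarrow>
            improper_integral_converges (H_integrand k z 0))"
  \<comment> \<open>The lower bound on \<open>Re z\<close> settles the endpoint 0 in both claims;
    the upper bound settles infinity, through oscillation for \<open>x > 0\<close> and through
    domination for \<open>x = 0\<close>.\<close>
  by (auto intro!: improper_integral_convergesI continuous_on_H_integrand H_convergent_at_right_0
      intro: H_convergent_at_top H_convergent_at_top_absolute)

end
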